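(* Consider the scalar equation $\dot{x}(t)+\sum_{k=1}^m a_k(t)x(h_k(t))=0$ and suppose $a_k(t)\ge0$ for $k=1,\dots,m$. If this equation is asymptotically stable, then the ordinary differential equation $$\dot{x}(t)+\left(\sum_{k=1}^m a_k(t)\right)x(t)=0$$ is also asymptotically stable. If in addition $\limsup_{t\to\infty}(t-h_k(t))<\infty$ for $k=1,\dots,m$ and the delay equation $\dot{x}(t)+\sum_{k=1}^m a_k(t)x(h_k(t))=0$ is exponentially stable, then the ordinary differential equation above is also exponentially stable.
   Context: Standing assumptions: $a_k:[0,\infty)\to\mathbb{R}$ are Lebesgue measurable and essentially bounded; $h_k:[0,\infty)\to\mathbb{R}$ are Lebesgue measurable, $h_k(t)\le t$, $\lim_{t\to\infty}h_k(t)=\infty$. For any $t_0\ge 0$, $x_0\in\mathbb{R}$ and any bounded Borel measurable $\varphi:(-\infty,t_0)\to\mathbb{R}$, the solution of the equation with initial conditions $x(t)=\varphi(t)$ for $t<t_0$, $x(t_0)=x_0$ is the function satisfying these conditions which is locally absolutely continuous on $[t_0,\infty)$ and satisfies the equation for almost all $t\ge t_0$. The equation is stable if for every $t_0\ge0$ and $\varepsilon>0$ there is $\delta>0$ such that $\sup_{t<t_0}|\varphi(t)|+|x(t_0)|<\delta$ implies $|x(t)|<\varepsilon$ for $t\ge t_0$. It is asymptotically stable if it is stable and, for every $t_0\ge0$, all solutions tend to zero as $t\to\infty$. It is exponentially stable if there are $M>0,\mu>0$, independent of $t_0$ and of the initial data, such that every solution satisfies $|x(t)|\le Me^{-\mu(t-t_0)}\left(|x(t_0)|+\sup_{t<t_0}|\varphi(t)|\right)$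 for $t\ge t_0$. The ordinary differential equation is the special case of one term with $h(t)=t$ (its solutions for $t\ge t_0$ depend only on $x(t_0)$). *)

theory Defs
  imports "HOL-Analysis.Analysis"
begin

text \<open>The sub-intervals \<open>[u i, v i]\<close> may share end points but do not overlap otherwise.\<close>

definition absolutely_continuous_on_interval :: "real \<Rightarrow> real \<Rightarrow> (real \<Rightarrow> real) \<Rightarrow> bool" where
  "absolutely_continuous_on_interval c d f \<longleftrightarrow>
     (\<forall>\<epsilon>>0. \<exists>\<delta>>0. \<forall>(n::nat) (u::nat \<Rightarrow> real) (v::nat \<Rightarrow> real).
        (\<forall>i<n. c \<le> u i \<and> u i \<le> v i \<and> v i \<le> d) \<and>
        disjoint_family_on (\<lambda>i. {u i<..<v i}) {..<n} \<and>
        (\<Sum>i<n. v i - u i) < \<delta> \<longrightarrow>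
        (\<Sum>i<n. \<bar>f (v i) - f (u i)\<bar>) < \<epsilon>)"

definition locally_absolutely_continuous_from :: "real \<Rightarrow> (real \<Rightarrow> real) \<Rightarrow> bool" where
  "locally_absolutely_continuous_from t0 f \<longleftrightarrow>
     (\<forall>d>t0. absolutely_continuous_on_interval t0 d f)"

text \<open>Only the restriction of \<open>\<phi>\<close> to \<open>(-\<infinity>, t0)\<close> matters.\<close>

definition initial_function :: "real \<Rightarrow> (real \<Rightarrow> real) \<Rightarrow> bool" where
  "initial_function t0 \<phi> \<longleftrightarrow>
     \<phi> \<in> borel_measurable (restrict_space borel {..<t0}) \<and> bounded (\<phi> ` {..<t0})"

text \<open>
  The parameters \<open>m\<close>, \<open>a\<close>, \<open>h\<close> stand for the equation
  \<open>x'(t) + (\<Sum>k=1..m. a k t * x (h k t)) = 0\<close> on \<open>[0, \<infinity>)\<close>; the values of \<open>a k\<close> and \<open>h k\<close> at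
  negative arguments are irrelevant.
\<close>

definition is_solution ::
  "nat \<Rightarrow> (nat \<Rightarrow> real \<Rightarrow> real) \<Rightarrow> (nat \<Rightarrow> real \<Rightarrow> real) \<Rightarrow>
   real \<Rightarrow> (real \<Rightarrow> real) \<Rightarrow> real \<Rightarrow> (real \<Rightarrow> real) \<Rightarrow> bool" where
  "is_solution m a h t0 \<phi> x0 x \<longleftrightarrow>
     (\<forall>t<t0. x t = \<phi> t) \<and> x t0 = x0 \<and>
     locally_absolutely_continuous_from t0 x \<and>
     (AE t in lebesgue_on {t0..}.
        \<exists>x'. (x has_real_derivative x') (at t) \<and> x' + (\<Sum>k=1..m. a k t * x (h k t)) = 0)"

definition stable ::
  "nat \<Rightarrow> (nat \<Rightarrow> real \<Rightarrow> real) \<Rightarrow> (nat \<Rightarrow> real \<Rightarrow> real) \<Rightarrow> bool" where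
  "stable m a h \<longleftrightarrow>
     (\<forall>t0\<ge>0. \<forall>\<epsilon>>0. \<exists>\<delta>>0. \<forall>\<phi> x0 x.
        initial_function t0 \<phi> \<and> is_solution m a h t0 \<phi> x0 x \<and>
        (SUP t\<in>{..<t0}. \<bar>\<phi> t\<bar>) + \<bar>x0\<bar> < \<delta> \<longrightarrow>
        (\<forall>t\<ge>t0. \<bar>x t\<bar> < \<epsilon>))"

definition asymptotically_stable ::
  "nat \<Rightarrow> (nat \<Rightarrow> real \<Rightarrow> real) \<Rightarrow> (nat \<Rightarrow> real \<Rightarrow> real) \<Rightarrow> bool" where
  "asymptotically_stable m a h \<longleftrightarrow>
     stable m a h \<and>
     (\<forall>t0\<ge>0. \<forall>\<phi> x0 x.
        initial_function t0 \<phi> \<and> is_solution m a h t0 \<phi> x0 x \<longrightarrow> (x \<longlongrightarrow> 0) at_top)"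

definition exponentially_stable ::
  "nat \<Rightarrow> (nat \<Rightarrow> real \<Rightarrow> real) \<Rightarrow> (nat \<Rightarrow> real \<Rightarrow> real) \<Rightarrow> bool" where
  "exponentially_stable m a h \<longleftrightarrow>
     (\<exists>M>0. \<exists>\<mu>>0. \<forall>t0\<ge>0. \<forall>\<phi> x0 x.
        initial_function t0 \<phi> \<and> is_solution m a h t0 \<phi> x0 x \<longrightarrow>
        (\<forall>t\<ge>t0. \<bar>x t\<bar> \<le> M * exp (- \<mu> * (t - t0)) * (\<bar>x0\<bar> + (SUP s\<in>{..<t0}. \<bar>\<phi> s\<bar>))))"

end

(* If x solves the delay equation with initial data identically 1 at t0, then x stays within 1/3 of 1
   as long as the integral of A = a_1 + ... + a_m from t0 is at most 1/4: if K is the maximum of |x| up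
   to that time, then |x - 1| <= K/4. Hence asymptotic stability of the delay equation forces the
   integral of A over [t0, oo) to exceed 1/4 for every t0, so it diverges. Exponential stability even
   gives a length L, independent of t0, such that the integral of A over [t0, t0 + L] is at least 1/4.
   Solutions of the ordinary equation are multiples of exp (- integral of A). *)

theory Submission
  imports Defs
begin

text \<open>Stability speaks only of given solutions, so it yields nothing until a solution of the
  delay equation has been built, while for the ordinary equation a formula must be proved for every
  solution. Since the coefficients are merely measurable, both tasks take place almost everywhere:
  they rest on the differentiation of indefinite integrals, and the second also on the fact that an
  absolutely continuous function with derivative 0 almost everywhere is constant. Both facts are
  obtained from gauges and fine tagged families of intervals. The numbers 1/4 and 1/3 belong
  together: at a point where the maximum K is attained, K \<le> 1 + K/4, so K \<le> 4/3 and the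
  deviation K/4 is at most 1/3.\<close>

subsection \<open>Almost everywhere differentiability of indefinite integrals\<close>

text \<open>A Vitali subfamily of the exceptional intervals \<open>[u, v]\<close>, tagged by \<open>t\<close>, forms a fine partial
  division, so Henstock's lemma bounds its total length.\<close>

lemma negligible_Henstock_exceptional:
  fixes f :: "real \<Rightarrow> real"
  assumes f: "f integrable_on {a..b}" and e: "e > 0"
  shows "negligible {t \<in> {a..b}. \<forall>d>0. \<exists>u v. a \<le> u \<and> u < v \<and> v \<le> b \<and> t \<in> {u..v} \<and> v - u < d \<and>
           e * (v - u) \<le> \<bar>(v - u) * f t - integral {u..v} f\<bar>}" (is "negligible ?S")
  unfolding negligible_outer_le
proof (intro allI impI)
  fix \<eta> :: real assume "\<eta> > 0"
  then have "e * \<eta> > 0" using e by simp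
  then obtain \<gamma> where \<gamma>: "gauge \<gamma>" and Hen: "\<And>p. \<lbrakk>p tagged_partial_division_of (cbox a b); \<gamma> fine p\<rbrakk> \<Longrightarrow>
             sum (\<lambda>(x,k). norm(measure lborel k *\<^sub>R f x - integral k f)) p < e * \<eta>"
    using Henstock_lemma[of f a b "e * \<eta>"] f by auto
  define bad where "bad = (\<lambda>(t, u, v). a \<le> u \<and> u < v \<and> v \<le> b \<and> t \<in> {u..v} \<and> {u..v} \<subseteq> \<gamma> t \<and>
           e * (v - u) \<le> \<bar>(v - u) * f t - integral {u..v} f\<bar>)"
  define c r where "c = (\<lambda>(t::real, u::real, v::real). (u + v) / 2)"
    and "r = (\<lambda>(t::real, u::real, v::real). (v - u) / 2)"
  have cb: "cball (c (t, u, v)) (r (t, u, v)) = {u..v}" for t u v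
    by (auto simp: c_def r_def cball_eq_atLeastAtMost field_simps)
  obtain C where C: "countable C" "C \<subseteq> Collect bad"
     "pairwise (\<lambda>i j. disjnt (cball (c i) (r i)) (cball (c j) (r j))) C"
     "negligible (?S - (\<Union>i \<in> C. cball (c i) (r i)))"
  proof (rule Vitali_covering_theorem_cballs[of "Collect bad" r ?S c])
    show "0 < r i" if "i \<in> Collect bad" for i
      using that by (auto simp: bad_def r_def)
    fix t d :: real assume t: "t \<in> ?S" and d: "0 < d"
    obtain \<rho> where \<rho>: "\<rho> > 0" "ball t \<rho> \<subseteq> \<gamma> t"
      using \<gamma> unfolding gauge_def by (meson open_contains_ball)
    have "min d \<rho> > 0" using d \<rho> by simp
    then obtain u v where uv: "a \<le> u" "u < v" "v \<le> b" "t \<in> {u..v}" "v - u < min d \<rho>"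
           "e * (v - u) \<le> \<bar>(v - u) * f t - integral {u..v} f\<bar>"
      using t by blast
    have "{u..v} \<subseteq> ball t \<rho>"
      using uv by (auto simp: dist_real_def)
    then have "(t, u, v) \<in> Collect bad"
      using uv \<rho> by (auto simp: bad_def)
    moreover have "t \<in> cball (c (t, u, v)) (r (t, u, v))"
      using uv(4) cb by blast
    moreover have "r (t, u, v) < d"
      using uv by (simp add: r_def)
    ultimately show "\<exists>i. i \<in> Collect bad \<and> t \<in> cball (c i) (r i) \<and> r i < d"
      by blast
  qed
  \<comment> \<open>Henstock's lemma concerns finite partial divisions. A bound common to all finite
    subfamilies carries over to the countable union.\<close>
  have fin: "measure lebesgue (\<Union>i\<in>D. cball (c i) (r i)) \<le> \<eta>" if D: "D \<subseteq> C" "finite D" for D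
  proof -
    define g where "g = (\<lambda>(t::real, u::real, v::real). (t, {u..v}))"
    have gc: "g i = (fst i, cball (c i) (r i))" for i
      by (cases i) (simp add: g_def cb)
    have bad: "bad i" if "i \<in> D" for i using that D C by auto
    have disj: "cball (c i) (r i) \<inter> cball (c j) (r j) = {}" if "i \<in> D" "j \<in> D" "i \<noteq> j" for i j
      using C(3) D that unfolding pairwise_def disjnt_def by blast
    have ne: "cball (c i) (r i) \<noteq> {}" if "i \<in> D" for i
      using bad[OF that] by (auto simp: bad_def r_def)
    have inj: "inj_on g D"
    proof (rule inj_onI, rule ccontr)
      fix i j assume ij: "i \<in> D" "j \<in> D" "g i = g j" "i \<noteq> j"
      then have "cball (c i) (r i) = cball (c j) (r j)" by (simp add: gc)
      then show False using disj[OF ij(1,2,4)] ne[OF ij(1)] by simp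
    qed
    have tp: "g ` D tagged_partial_division_of cbox a b"
      unfolding tagged_partial_division_of_def
    proof (intro conjI allI impI)
      show "finite (g ` D)" using D by simp
      fix x K assume "(x, K) \<in> g ` D"
      then obtain t u v where i: "(t, u, v) \<in> D" "x = t" "K = {u..v}"
        by (auto simp: g_def)
      note b = bad[OF i(1), unfolded bad_def, simplified]
      show "x \<in> K" "K \<subseteq> cbox a b" "\<exists>a b. K = cbox a b"
        using b i by (auto intro: exI[of _ u] exI[of _ v])
    next
      fix x1 K1 x2 K2 assume A: "(x1, K1) \<in> g ` D \<and> (x2, K2) \<in> g ` D \<and> (x1, K1) \<noteq> (x2, K2)"
      then obtain i j where "i \<in> D" "j \<in> D" "g i = (x1, K1)" "g j = (x2, K2)" "i \<noteq> j"
        by (metis imageE)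
      then show "interior K1 \<inter> interior K2 = {}"
        using disj[of i j] interior_subset[of K1] interior_subset[of K2] unfolding gc by auto
    qed
    have fine: "\<gamma> fine (g ` D)"
      unfolding fine_def by (auto simp: g_def dest!: bad simp: bad_def subset_iff)
    \<comment> \<open>On a bad interval, \<open>e\<close> times the length is at most the Henstock
      error; summing keeps the total below \<open>e * \<eta>\<close>.\<close>
    have "e * measure lebesgue (\<Union>i\<in>D. cball (c i) (r i)) = e * (\<Sum>i\<in>D. measure lebesgue (cball (c i) (r i)))"
    proof (subst measure_finite_Union)
      show "disjoint_family_on (\<lambda>i. cball (c i) (r i)) D"
        using disj by (auto simp: disjoint_family_on_def)
      show "emeasure lebesgue (cball (c i) (r i)) \<noteq> \<infinity>" for i
        using lmeasurable_cball[of "c i" "r i"] by (auto simp: fmeasurable_def)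
    qed (use D in auto)
    also have "\<dots> = (\<Sum>i\<in>D. e * measure lebesgue (cball (c i) (r i)))"
      by (simp add: sum_distrib_left)
    also have "\<dots> \<le> (\<Sum>i\<in>D. case g i of (x, k) \<Rightarrow> norm (measure lborel k *\<^sub>R f x - integral k f))"
    proof (rule sum_mono)
      fix i assume i: "i \<in> D"
      obtain t u v where [simp]: "i = (t, u, v)" by (cases i)
      show "e * measure lebesgue (cball (c i) (r i)) \<le> (case g i of (x, k) \<Rightarrow> norm (measure lborel k *\<^sub>R f x - integral k f))"
        using bad[OF i] by (simp add: bad_def g_def cb)
    qed
    also have "\<dots> = (\<Sum>(x,k)\<in>g ` D. norm (measure lborel k *\<^sub>R f x - integral k f))"
      by (simp add: sum.reindex[OF inj])
    also have "\<dots> < e * \<eta>"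
      by (rule Hen[OF tp fine])
    finally show ?thesis using e by simp
  qed
  let ?U = "\<Union>i\<in>C. cball (c i) (r i)"
  have U: "?U \<in> lmeasurable" "measure lebesgue ?U \<le> \<eta>"
    by (rule fmeasurable_UN_bound[OF C(1) _ fin] measure_UN_bound[OF C(1) _ fin]; simp)+
  show "\<exists>T. ?S \<subseteq> T \<and> T \<in> lmeasurable \<and> measure lebesgue T \<le> \<eta>"
  proof (intro exI conjI)
    show "?S \<subseteq> (?S - ?U) \<union> ?U" by blast
    show "(?S - ?U) \<union> ?U \<in> lmeasurable"
      using U C(4) by (intro fmeasurable.Un negligible_imp_measurable[OF C(4)])
    have "measure lebesgue ((?S - ?U) \<union> ?U) \<le> measure lebesgue (?S - ?U) + measure lebesgue ?U"
      using U C(4) by (intro measure_Un_le) (auto dest: negligible_imp_measurable)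
    then show "measure lebesgue ((?S - ?U) \<union> ?U) \<le> \<eta>"
      using U(2) negligible_imp_measure0[OF C(4)] by linarith
  qed
qed

text \<open>Lebesgue's differentiation theorem on the line. If the difference quotients at
  \<open>t\<close> do not converge to \<open>f t\<close>, they miss it by at least some
  \<open>1 / Suc n\<close> at arbitrarily small scales, so \<open>t\<close> lies in one of countably
  many negligible exceptional sets.\<close>

lemma integral_has_real_derivative_AE:
  fixes f :: "real \<Rightarrow> real"
  assumes f: "f integrable_on {a..b}"
  shows "negligible {t \<in> {a<..<b}. \<not> ((\<lambda>x. integral {a..x} f) has_real_derivative f t) (at t)}"
    (is "negligible ?B")
proof -
  define S where "S e = {t \<in> {a..b}. \<forall>d>0. \<exists>u v. a \<le> u \<and> u < v \<and> v \<le> b \<and> t \<in> {u..v} \<and> v - u < d \<and>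
           e * (v - u) \<le> \<bar>(v - u) * f t - integral {u..v} f\<bar>}" for e :: real
  have "negligible (\<Union>n. S (1 / real (Suc n)))"
    unfolding S_def by (intro negligible_Union_nat negligible_Henstock_exceptional f) simp
  moreover have "?B \<subseteq> (\<Union>n. S (1 / real (Suc n)))"
  proof
    fix t assume t: "t \<in> ?B"
    show "t \<in> (\<Union>n. S (1 / real (Suc n)))"
    proof (rule ccontr)
      assume nS: "t \<notin> (\<Union>n. S (1 / real (Suc n)))"
      let ?F = "\<lambda>x. integral {a..x} f"
      have "((\<lambda>y. (?F y - ?F t) / (y - t)) \<longlongrightarrow> f t) (at t)"
      proof (rule tendstoI)
        fix e :: real assume "e > 0"
        then obtain n where n: "1 / real (Suc n) < e"
          using nat_approx_posE by blast
        have "t \<notin> S (1 / real (Suc n))" using nS by blast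
        then obtain d where d: "d > 0" and dd: "\<And>u v. a \<le> u \<Longrightarrow> u < v \<Longrightarrow> v \<le> b \<Longrightarrow> t \<in> {u..v} \<Longrightarrow> v - u < d \<Longrightarrow>
           \<bar>(v - u) * f t - integral {u..v} f\<bar> < 1 / real (Suc n) * (v - u)"
        proof -
          have "t \<in> {a..b}" using t by auto
          with \<open>t \<notin> S (1 / real (Suc n))\<close> show ?thesis
            unfolding S_def using that by (simp only: mem_Collect_eq) (meson not_le)
        qed
        define r where "r = min d (min (t - a) (b - t))"
        have r: "r > 0" using t d by (auto simp: r_def)
        have "dist ((?F y - ?F t) / (y - t)) (f t) < e" if y: "y \<noteq> t" "dist y t < r" for y
        proof -
          \<comment> \<open>Ordering \<open>y\<close> and \<open>t\<close> treats left and right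
            quotients alike: both are the mean of \<open>f\<close> over
            \<open>{u..v}\<close>.\<close>
          define u v where "u = min y t" and "v = max y t"
          have uv: "a \<le> u" "u < v" "v \<le> b" "t \<in> {u..v}" "v - u < d"
            using y t by (auto simp: u_def v_def r_def dist_real_def)
          have "f integrable_on {a..v}"
            using integrable_subinterval_real[OF f] uv by auto
          then have I: "integral {a..u} f + integral {u..v} f = integral {a..v} f"
            using uv by (intro Henstock_Kurzweil_Integration.integral_combine) auto
          have "(?F y - ?F t) / (y - t) = integral {u..v} f / (v - u)"
          proof (cases "y < t")
            case True
            then have "u = y" "v = t" by (auto simp: u_def v_def)
            then have "?F y - ?F t = - integral {u..v} f" "y - t = - (v - u)" using I by auto
            then show ?thesis by (simp only: minus_divide_divide)
          next
            case False
            then have "u = t" "v = y" by (auto simp: u_def v_def)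
            then have "?F y - ?F t = integral {u..v} f" "y - t = v - u" using I by auto
            then show ?thesis by simp
          qed
          then have "(?F y - ?F t) / (y - t) - f t = - (((v - u) * f t - integral {u..v} f) / (v - u))"
            using uv by (simp add: field_simps)
          then have "dist ((?F y - ?F t) / (y - t)) (f t) = \<bar>(v - u) * f t - integral {u..v} f\<bar> / (v - u)"
            using uv by (simp add: dist_real_def)
          also have "\<dots> < 1 / real (Suc n)"
            using dd[OF uv] uv by (simp add: divide_less_eq)
          finally show ?thesis using n by linarith
        qed
        then show "\<forall>\<^sub>F y in at t. dist ((?F y - ?F t) / (y - t)) (f t) < e"
          using r by (auto simp: eventually_at)
      qed
      then have "(?F has_real_derivative f t) (at t)"
        by (simp add: has_field_derivative_iff)
      with t show False by simp
    qed
  qed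
  ultimately show ?thesis
    by (rule negligible_subset)
qed

subsection \<open>Absolutely continuous functions\<close>

lemma AE_lebesgue_on_iff_negligible:
  assumes "S \<in> sets lebesgue"
  shows "(AE t in lebesgue_on S. P t) \<longleftrightarrow> negligible {t \<in> S. \<not> P t}"
proof -
  have "(AE t in lebesgue_on S. P t) \<longleftrightarrow> (AE t in lebesgue. t \<in> S \<longrightarrow> P t)"
    using assms by (subst AE_restrict_space_iff) auto
  also have "\<dots> \<longleftrightarrow> negligible {t \<in> S. \<not> P t}"
    unfolding eventually_ae_filter_negligible
    by (auto intro: negligible_subset)
  finally show ?thesis .
qed

lemma absolutely_continuous_imp_continuous_on:
  assumes "absolutely_continuous_on_interval c d f"
  shows "continuous_on {c..d} f"
  unfolding continuous_on_iff
proof (intro ballI allI impI)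
  fix x e :: real assume x: "x \<in> {c..d}" and e: "e > 0"
  obtain \<delta> where \<delta>: "\<delta> > 0" "\<forall>(n::nat) u v. (\<forall>i<n. c \<le> u i \<and> u i \<le> v i \<and> v i \<le> d) \<and>
        disjoint_family_on (\<lambda>i. {u i<..<v i}) {..<n} \<and> (\<Sum>i<n. v i - u i) < \<delta> \<longrightarrow>
        (\<Sum>i<n. \<bar>f (v i) - f (u i)\<bar>) < e"
    using assms e unfolding absolutely_continuous_on_interval_def by blast
  have "dist (f y) (f x) < e" if y: "y \<in> {c..d}" "dist y x < \<delta>" for y
    using \<delta>(2)[rule_format, of "Suc 0" "\<lambda>_. min x y" "\<lambda>_. max x y"] x y
    by (cases "x \<le> y") (auto simp: disjoint_family_on_def dist_real_def)
  then show "\<exists>d'>0. \<forall>y\<in>{c..d}. dist y x < d' \<longrightarrow> dist (f y) (f x) < e"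
    using \<delta>(1) by blast
qed

lemma absolutely_continuous_Lipschitz:
  assumes L: "\<And>u v. c \<le> u \<Longrightarrow> u \<le> v \<Longrightarrow> v \<le> d \<Longrightarrow> \<bar>f v - f u\<bar> \<le> L * (v - u)"
  shows "absolutely_continuous_on_interval c d f"
  unfolding absolutely_continuous_on_interval_def
proof (intro allI impI)
  fix \<epsilon> :: real assume \<epsilon>: "\<epsilon> > 0"
  \<comment> \<open>The hypothesis does not force \<open>L > 0\<close>, and \<open>L'\<close> is
    needed as a positive divisor.\<close>
  define L' where "L' = max L 1"
  have L': "L' > 0" by (simp add: L'_def)
  have "(\<Sum>i<n. \<bar>f (v i) - f (u i)\<bar>) < \<epsilon>"
    if uv: "\<forall>i<n. c \<le> u i \<and> u i \<le> v i \<and> v i \<le> d" and s: "(\<Sum>i<n. v i - u i) < \<epsilon> / L'"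
    for n :: nat and u v
  proof -
    have "(\<Sum>i<n. \<bar>f (v i) - f (u i)\<bar>) \<le> (\<Sum>i<n. L' * (v i - u i))"
    proof (rule sum_mono)
      fix i assume "i \<in> {..<n}"
      then have "\<bar>f (v i) - f (u i)\<bar> \<le> L * (v i - u i)" "0 \<le> v i - u i"
        using uv L by auto
      moreover have "L * (v i - u i) \<le> L' * (v i - u i)"
        using calculation by (intro mult_right_mono) (auto simp: L'_def)
      ultimately show "\<bar>f (v i) - f (u i)\<bar> \<le> L' * (v i - u i)" by linarith
    qed
    also have "\<dots> = (\<Sum>i<n. v i - u i) * L'" by (simp add: sum_distrib_left mult.commute)
    also have "\<dots> < \<epsilon>" using s L' by (simp add: pos_less_divide_eq)
    finally show ?thesis .
  qed
  note key = this
  show "\<exists>\<delta>>0. \<forall>(n::nat) u v. (\<forall>i<n. c \<le> u i \<and> u i \<le> v i \<and> v i \<le> d) \<and>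
        disjoint_family_on (\<lambda>i. {u i<..<v i}) {..<n} \<and> (\<Sum>i<n. v i - u i) < \<delta> \<longrightarrow>
        (\<Sum>i<n. \<bar>f (v i) - f (u i)\<bar>) < \<epsilon>"
  proof (intro exI[of _ "\<epsilon> / L'"] conjI allI impI)
    show "0 < \<epsilon> / L'" using \<epsilon> L' by simp
    fix n :: nat and u v :: "nat \<Rightarrow> real"
    assume "(\<forall>i<n. c \<le> u i \<and> u i \<le> v i \<and> v i \<le> d) \<and>
        disjoint_family_on (\<lambda>i. {u i<..<v i}) {..<n} \<and> (\<Sum>i<n. v i - u i) < \<epsilon> / L'"
    then show "(\<Sum>i<n. \<bar>f (v i) - f (u i)\<bar>) < \<epsilon>"
      using key[of n u v] by blast
  qed
qed

text \<open>Serves the product of a solution with an integrating factor. Each factor is bounded,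
  being continuous on a compact interval, and its increments are made small relative to the bound of
  the other factor.\<close>

lemma absolutely_continuous_mult:
  assumes f: "absolutely_continuous_on_interval c d f" and g: "absolutely_continuous_on_interval c d g"
  shows "absolutely_continuous_on_interval c d (\<lambda>t. f t * g t)"
  unfolding absolutely_continuous_on_interval_def
proof (intro allI impI)
  fix \<epsilon> :: real assume \<epsilon>: "\<epsilon> > 0"
  have bdd: "\<exists>B>0. \<forall>t\<in>{c..d}. \<bar>k t\<bar> \<le> B" if "absolutely_continuous_on_interval c d k" for k
  proof -
    have "bounded (k ` {c..d})"
      by (intro compact_imp_bounded compact_continuous_image absolutely_continuous_imp_continuous_on that) auto
    then show ?thesis unfolding bounded_pos by auto
  qed
  obtain Bf Bg where Bf: "Bf > 0" "\<And>t. t \<in> {c..d} \<Longrightarrow> \<bar>f t\<bar> \<le> Bf"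
    and Bg: "Bg > 0" "\<And>t. t \<in> {c..d} \<Longrightarrow> \<bar>g t\<bar> \<le> Bg"
    using bdd[OF f] bdd[OF g] by auto
  have pos: "\<epsilon> / (2 * Bg) > 0" "\<epsilon> / (2 * Bf) > 0"
    using \<epsilon> Bf(1) Bg(1) by simp_all
  obtain \<delta>1 where \<delta>1: "\<delta>1 > 0" "\<forall>(n::nat) u v. (\<forall>i<n. c \<le> u i \<and> u i \<le> v i \<and> v i \<le> d) \<and>
        disjoint_family_on (\<lambda>i. {u i<..<v i}) {..<n} \<and> (\<Sum>i<n. v i - u i) < \<delta>1 \<longrightarrow>
        (\<Sum>i<n. \<bar>f (v i) - f (u i)\<bar>) < \<epsilon> / (2 * Bg)"
    using f pos(1) unfolding absolutely_continuous_on_interval_def by blast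
  obtain \<delta>2 where \<delta>2: "\<delta>2 > 0" "\<forall>(n::nat) u v. (\<forall>i<n. c \<le> u i \<and> u i \<le> v i \<and> v i \<le> d) \<and>
        disjoint_family_on (\<lambda>i. {u i<..<v i}) {..<n} \<and> (\<Sum>i<n. v i - u i) < \<delta>2 \<longrightarrow>
        (\<Sum>i<n. \<bar>g (v i) - g (u i)\<bar>) < \<epsilon> / (2 * Bf)"
    using g pos(2) unfolding absolutely_continuous_on_interval_def by blast
  have "(\<Sum>i<n. \<bar>f (v i) * g (v i) - f (u i) * g (u i)\<bar>) < \<epsilon>"
    if uv: "\<forall>i<n. c \<le> u i \<and> u i \<le> v i \<and> v i \<le> d" and dj: "disjoint_family_on (\<lambda>i. {u i<..<v i}) {..<n}"
      and s: "(\<Sum>i<n. v i - u i) < min \<delta>1 \<delta>2"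
    for n :: nat and u v
  proof -
    have "(\<Sum>i<n. \<bar>f (v i) * g (v i) - f (u i) * g (u i)\<bar>)
        \<le> (\<Sum>i<n. Bf * \<bar>g (v i) - g (u i)\<bar> + Bg * \<bar>f (v i) - f (u i)\<bar>)"
    proof (rule sum_mono)
      fix i assume i: "i \<in> {..<n}"
      have "f (v i) * g (v i) - f (u i) * g (u i) = f (v i) * (g (v i) - g (u i)) + g (u i) * (f (v i) - f (u i))"
        by (simp add: algebra_simps)
      also have "\<bar>\<dots>\<bar> \<le> \<bar>f (v i)\<bar> * \<bar>g (v i) - g (u i)\<bar> + \<bar>g (u i)\<bar> * \<bar>f (v i) - f (u i)\<bar>"
        by (metis abs_mult abs_triangle_ineq)
      also have "\<dots> \<le> Bf * \<bar>g (v i) - g (u i)\<bar> + Bg * \<bar>f (v i) - f (u i)\<bar>"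
        using uv i by (intro add_mono mult_right_mono Bf Bg) (auto intro: order_trans)
      finally show "\<bar>f (v i) * g (v i) - f (u i) * g (u i)\<bar> \<le> Bf * \<bar>g (v i) - g (u i)\<bar> + Bg * \<bar>f (v i) - f (u i)\<bar>" .
    qed
    also have "\<dots> = Bf * (\<Sum>i<n. \<bar>g (v i) - g (u i)\<bar>) + Bg * (\<Sum>i<n. \<bar>f (v i) - f (u i)\<bar>)"
      by (simp add: sum.distrib sum_distrib_left)
    also have "\<dots> < Bf * (\<epsilon> / (2 * Bf)) + Bg * (\<epsilon> / (2 * Bg))"
    proof (intro add_strict_mono mult_strict_left_mono Bf(1) Bg(1))
      show "(\<Sum>i<n. \<bar>f (v i) - f (u i)\<bar>) < \<epsilon> / (2 * Bg)"
        using uv dj s by (intro \<delta>1(2)[rule_format] conjI) simp_all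
      show "(\<Sum>i<n. \<bar>g (v i) - g (u i)\<bar>) < \<epsilon> / (2 * Bf)"
        using uv dj s by (intro \<delta>2(2)[rule_format] conjI) simp_all
    qed
    also have "\<dots> = \<epsilon>" using Bf(1) Bg(1) by simp
    finally show ?thesis .
  qed
  note key = this
  show "\<exists>\<delta>>0. \<forall>(n::nat) u v. (\<forall>i<n. c \<le> u i \<and> u i \<le> v i \<and> v i \<le> d) \<and>
        disjoint_family_on (\<lambda>i. {u i<..<v i}) {..<n} \<and> (\<Sum>i<n. v i - u i) < \<delta> \<longrightarrow>
        (\<Sum>i<n. \<bar>f (v i) * g (v i) - f (u i) * g (u i)\<bar>) < \<epsilon>"
  proof (intro exI[of _ "min \<delta>1 \<delta>2"] conjI allI impI)
    show "0 < min \<delta>1 \<delta>2" using \<delta>1(1) \<delta>2(1) by simp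
    fix n :: nat and u v :: "nat \<Rightarrow> real"
    assume "(\<forall>i<n. c \<le> u i \<and> u i \<le> v i \<and> v i \<le> d) \<and>
        disjoint_family_on (\<lambda>i. {u i<..<v i}) {..<n} \<and> (\<Sum>i<n. v i - u i) < min \<delta>1 \<delta>2"
    then show "(\<Sum>i<n. \<bar>f (v i) * g (v i) - f (u i) * g (u i)\<bar>) < \<epsilon>"
      using key[of n u v] by blast
  qed
qed

text \<open>This gives uniqueness for the ordinary equation. Over a tagged division of
  \<open>{a..b}\<close> the difference \<open>f b - f a\<close> telescopes, and each increment is
  estimated by what is known at its tag.\<close>

lemma absolutely_continuous_deriv_zero_imp_eq:
  assumes ac: "absolutely_continuous_on_interval a b f" and ab: "a \<le> b" and N: "negligible N"
    and deriv: "\<And>t. t \<in> {a..b} - N \<Longrightarrow> (f has_real_derivative 0) (at t)"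
  shows "f b = f a"
proof -
  have "\<bar>f b - f a\<bar> \<le> \<epsilon> * (1 + (b - a))" if \<epsilon>: "\<epsilon> > 0" for \<epsilon>
  proof -
    obtain \<delta> where \<delta>: "\<delta> > 0" "\<forall>(n::nat) u v. (\<forall>i<n. a \<le> u i \<and> u i \<le> v i \<and> v i \<le> b) \<and>
        disjoint_family_on (\<lambda>i. {u i<..<v i}) {..<n} \<and> (\<Sum>i<n. v i - u i) < \<delta> \<longrightarrow>
        (\<Sum>i<n. \<bar>f (v i) - f (u i)\<bar>) < \<epsilon>"
      using ac \<epsilon> unfolding absolutely_continuous_on_interval_def by blast
    have Nnull: "N \<in> null_sets lebesgue" using N negligible_iff_null_sets by blast
    then obtain G where G: "open G" "N \<subseteq> G" "emeasure lebesgue (G - N) < ennreal \<delta>"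
      using sets_lebesgue_outer_open[of N \<delta>] \<delta>(1) by (metis null_setsD2)
    have Gm: "emeasure lebesgue G < ennreal \<delta>"
      using G(1,3) by (simp add: emeasure_Diff_null_set[OF Nnull])
    have "\<exists>r>0. \<forall>y. \<bar>y - t\<bar> < r \<longrightarrow> \<bar>f y - f t\<bar> \<le> \<epsilon> * \<bar>y - t\<bar>" if t: "t \<in> {a..b} - N" for t
    proof -
      have "(f has_derivative (\<lambda>h. 0)) (at t)"
        using deriv[OF t] by (simp add: has_field_derivative_def lambda_zero)
      then show ?thesis
        using \<epsilon> unfolding has_derivative_at_alt by auto
    qed
    then obtain r where r: "\<And>t. t \<in> {a..b} - N \<Longrightarrow> r t > 0"
        "\<And>t y. t \<in> {a..b} - N \<Longrightarrow> \<bar>y - t\<bar> < r t \<Longrightarrow> \<bar>f y - f t\<bar> \<le> \<epsilon> * \<bar>y - t\<bar>"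
      by metis
    \<comment> \<open>Tags in \<open>N\<close> contribute little by absolute continuity, all others by differentiability.\<close>
    define \<gamma> where "\<gamma> t = (if t \<in> N then G else if t \<in> {a..b} then ball t (r t) else UNIV)" for t
    have "gauge \<gamma>"
      unfolding gauge_def \<gamma>_def using G r(1) by auto
    then obtain p where p: "p tagged_division_of {a..b}" "\<gamma> fine p"
      using fine_division_exists_real by blast
    have fin: "finite p" using p(1) by blast
    have pK: "\<exists>u v. K = {u..v} \<and> u \<le> t \<and> t \<le> v \<and> a \<le> u \<and> v \<le> b" if tK: "(t, K) \<in> p" for t K
    proof -
      obtain u v where "K = cbox u v" using tagged_division_ofD(4)[OF p(1) tK] by blast
      moreover have "t \<in> K" "K \<subseteq> {a..b}" using tagged_division_ofD(2,3)[OF p(1) tK] by auto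
      ultimately show ?thesis by auto
    qed
    define p1 p2 where "p1 = {q \<in> p. fst q \<in> N}" and "p2 = {q \<in> p. fst q \<notin> N}"
    have split: "p = p1 \<union> p2" "p1 \<inter> p2 = {}" "finite p1" "finite p2"
      using fin by (auto simp: p1_def p2_def)
    let ?\<Delta> = "\<lambda>q. \<bar>f (Sup (snd q)) - f (Inf (snd q))\<bar>"
    have "\<bar>f b - f a\<bar> = \<bar>\<Sum>(x,K)\<in>p. f (Sup K) - f (Inf K)\<bar>"
      using additive_tagged_division_1[OF ab p(1), of f] by simp
    also have "\<dots> \<le> (\<Sum>q\<in>p. ?\<Delta> q)"
      by (rule order_trans[OF sum_abs]) (simp add: case_prod_beta)
    also have "\<dots> = (\<Sum>q\<in>p1. ?\<Delta> q) + (\<Sum>q\<in>p2. ?\<Delta> q)"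
      using split by (simp add: sum.union_disjoint)
    also have "(\<Sum>q\<in>p2. ?\<Delta> q) \<le> \<epsilon> * (b - a)"
    proof -
      have "(\<Sum>q\<in>p2. ?\<Delta> q) \<le> (\<Sum>q\<in>p2. \<epsilon> * (Sup (snd q) - Inf (snd q)))"
      proof (rule sum_mono)
        fix q assume q: "q \<in> p2"
        obtain t K where [simp]: "q = (t, K)" by (cases q)
        have tp: "(t, K) \<in> p" "t \<notin> N" using q by (auto simp: p2_def)
        obtain u v where uv: "K = {u..v}" "u \<le> t" "t \<le> v" "a \<le> u" "v \<le> b" using pK[OF tp(1)] by blast
        have t: "t \<in> {a..b} - N" using uv tp by auto
        have "K \<subseteq> ball t (r t)" using p(2) tp t unfolding fine_def \<gamma>_def by fastforce
        moreover have "u \<in> K" "v \<in> K" using uv by auto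
        ultimately have "\<bar>u - t\<bar> < r t" "\<bar>v - t\<bar> < r t" by (auto simp: dist_real_def)
        then have "\<bar>f u - f t\<bar> \<le> \<epsilon> * (t - u)" "\<bar>f v - f t\<bar> \<le> \<epsilon> * (v - t)"
          using r(2)[OF t, of u] r(2)[OF t, of v] uv by auto
        moreover have "\<epsilon> * (t - u) + \<epsilon> * (v - t) = \<epsilon> * (v - u)" by (simp add: algebra_simps)
        ultimately show "?\<Delta> q \<le> \<epsilon> * (Sup (snd q) - Inf (snd q))"
          using uv by simp
      qed
      \<comment> \<open>Adding the other intervals back makes the lengths telescope to
        \<open>b - a\<close>.\<close>
      also have "\<dots> \<le> (\<Sum>q\<in>p. \<epsilon> * (Sup (snd q) - Inf (snd q)))"
      proof (rule sum_mono2[OF fin])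
        show "p2 \<subseteq> p" by (auto simp: p2_def)
        show "0 \<le> \<epsilon> * (Sup (snd q) - Inf (snd q))" if "q \<in> p - p2" for q
          using that pK[of "fst q" "snd q"] \<epsilon> by fastforce
      qed
      also have "\<dots> = \<epsilon> * (\<Sum>(x,K)\<in>p. Sup K - Inf K)"
        by (simp add: sum_distrib_left case_prod_beta)
      also have "\<dots> = \<epsilon> * (b - a)"
        using additive_tagged_division_1[OF ab p(1), of "\<lambda>x. x"] by simp
      finally show ?thesis .
    qed
    also have "(\<Sum>q\<in>p1. ?\<Delta> q) \<le> \<epsilon>"
    proof -
      \<comment> \<open>Absolute continuity is stated for families indexed by \<open>i < n\<close>,
        so the intervals tagged in \<open>N\<close> are enumerated.\<close>
      obtain e where e: "bij_betw e {..<card p1} p1"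
        using bij_betw_from_nat_into_finite split(3) by blast
      define u v where "u i = Inf (snd (e i))" and "v i = Sup (snd (e i))" for i
      have ep: "e i \<in> p1" if "i < card p1" for i
        using e that by (auto dest: bij_betwE)
      have uv: "snd (e i) = {u i..v i} \<and> a \<le> u i \<and> u i \<le> v i \<and> v i \<le> b \<and> {u i..v i} \<subseteq> G" if "i < card p1" for i
      proof -
        obtain t K where tK: "e i = (t, K)" by (cases "e i")
        have tp: "(t, K) \<in> p" "t \<in> N" using ep[OF that] tK by (auto simp: p1_def)
        have "K \<subseteq> G" using p(2) tp unfolding fine_def \<gamma>_def by fastforce
        then show ?thesis
          using pK[OF tp(1)] tK by (auto simp: u_def v_def)
      qed
      have dj: "disjoint_family_on (\<lambda>i. {u i<..<v i}) {..<card p1}"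
        unfolding disjoint_family_on_def
      proof (intro ballI impI)
        fix i j assume ij: "i \<in> {..<card p1}" "j \<in> {..<card p1}" "i \<noteq> j"
        then have "e i \<noteq> e j" using e by (auto simp: bij_betw_def inj_on_def)
        moreover have "e i \<in> p" "e j \<in> p" using ep ij by (auto simp: p1_def)
        ultimately have "interior (snd (e i)) \<inter> interior (snd (e j)) = {}"
          using tagged_division_ofD(5)[OF p(1), of "fst (e i)" "snd (e i)" "fst (e j)" "snd (e j)"] by simp
        then show "{u i<..<v i} \<inter> {u j<..<v j} = {}"
          using uv[of i] uv[of j] ij by (simp add: interior_atLeastAtMost_real)
      qed
      \<comment> \<open>The open intervals are disjoint and lie in \<open>G\<close>, so their total
        length is below \<open>\<delta>\<close>.\<close>
      have "ennreal (\<Sum>i<card p1. v i - u i) = (\<Sum>i<card p1. emeasure lebesgue {u i<..<v i})"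
        using uv by (subst sum_ennreal[symmetric]) (auto simp: less_imp_le)
      also have "\<dots> = emeasure lebesgue (\<Union>i<card p1. {u i<..<v i})"
        using dj by (intro sum_emeasure) auto
      also have "\<dots> \<le> emeasure lebesgue G"
      proof (rule emeasure_mono)
        show "(\<Union>i<card p1. {u i<..<v i}) \<subseteq> G"
          using uv greaterThanLessThan_subseteq_atLeastAtMost_iff by fastforce
      qed (use G in auto)
      also have "\<dots> < ennreal \<delta>" by (rule Gm)
      finally have "(\<Sum>i<card p1. v i - u i) < \<delta>"
        by (meson ennreal_leI not_le)
      then have "(\<Sum>i<card p1. \<bar>f (v i) - f (u i)\<bar>) < \<epsilon>"
        using uv dj by (intro \<delta>(2)[rule_format]) auto
      moreover have "(\<Sum>i<card p1. \<bar>f (v i) - f (u i)\<bar>) = (\<Sum>q\<in>p1. ?\<Delta> q)"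
        unfolding u_def v_def by (rule sum.reindex_bij_betw[OF e])
      ultimately show ?thesis by linarith
    qed
    finally show ?thesis by (simp add: algebra_simps)
  qed
  note * = this
  have "\<bar>f b - f a\<bar> \<le> 0 + e" if "e > 0" for e
    using *[of "e / (1 + (b - a))"] that ab by simp
  then have "\<bar>f b - f a\<bar> \<le> 0" by (rule field_le_epsilon)
  then show ?thesis by simp
qed

subsection \<open>The ordinary differential equation\<close>

lemma bounded_measurable_integrable_on_interval:
  fixes g :: "real \<Rightarrow> real"
  assumes g: "g \<in> borel_measurable lebesgue" and B: "\<And>t. t \<in> {a..b} \<Longrightarrow> \<bar>g t\<bar> \<le> B"
  shows "g integrable_on {a..b}"
  using measurable_bounded_by_integrable_imp_integrable_real[of g "{a..b}" "\<lambda>_. B"] assms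
  by (auto intro: measurable_restrict_space1)

lemma integral_interval_bounds:
  fixes A :: "real \<Rightarrow> real"
  assumes A: "A integrable_on {a..c}" and bnd: "\<And>t. 0 \<le> A t" "\<And>t. A t \<le> C"
    and ab: "a \<le> b" "b \<le> c"
  shows "0 \<le> integral {a..c} A - integral {a..b} A"
    and "integral {a..c} A - integral {a..b} A \<le> C * (c - b)"
proof -
  have eq: "integral {a..c} A - integral {a..b} A = integral {b..c} A"
    using Henstock_Kurzweil_Integration.integral_combine[OF ab A] by simp
  have i: "A integrable_on {b..c}" using integrable_subinterval_real[OF A] ab by auto
  show "0 \<le> integral {a..c} A - integral {a..b} A"
    unfolding eq using bnd by (intro integral_nonneg i) auto
  have "integral {b..c} A \<le> integral {b..c} (\<lambda>_. C)"
    using bnd by (intro integral_le i) auto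
  then show "integral {a..c} A - integral {a..b} A \<le> C * (c - b)"
    unfolding eq using ab by (simp add: mult.commute)
qed

text \<open>Integrating factor: \<open>x t * exp (I t)\<close> is absolutely continuous with
  derivative 0 almost everywhere, hence constant.\<close>

lemma ode_solution_eq:
  fixes A :: "real \<Rightarrow> real"
  assumes A: "A \<in> borel_measurable lebesgue" and bnd: "\<And>t. 0 \<le> A t" "\<And>t. A t \<le> C"
    and sol: "is_solution 1 (\<lambda>_. A) (\<lambda>_ t. t) t0 \<phi> x0 x" and T: "t0 \<le> T"
  shows "x T = x0 * exp (- integral {t0..T} A)"
proof (cases "t0 = T")
  case True
  then show ?thesis using sol by (simp add: is_solution_def)
next
  case False
  then have T: "t0 < T" using T by simp
  have A_int: "A integrable_on {a..b}" for a b
    using bnd by (intro bounded_measurable_integrable_on_interval[OF A, of _ _ C]) auto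
  define I where "I t = integral {t0..t} A" for t
  have x0: "x t0 = x0" and acx: "absolutely_continuous_on_interval t0 T x"
    using sol T by (auto simp: is_solution_def locally_absolutely_continuous_from_def)
  have I: "0 \<le> I v - I u" "I v - I u \<le> C * (v - u)" if "t0 \<le> u" "u \<le> v" for u v
    unfolding I_def using that integral_interval_bounds[OF A_int bnd] by auto
  have acE: "absolutely_continuous_on_interval t0 T (\<lambda>t. exp (I t))"
  proof (rule absolutely_continuous_Lipschitz)
    fix u v assume uv: "t0 \<le> u" "u \<le> v" "v \<le> T"
    \<comment> \<open>The tangent inequality for \<open>exp\<close> bounds the increment by
      \<open>exp (I v) * (I v - I u)\<close>. As \<open>I\<close> increases and is Lipschitz,
      \<open>exp (I t)\<close> is Lipschitz up to \<open>T\<close>.\<close>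
    have "1 + (I u - I v) \<le> exp (I u - I v)" by (rule exp_ge_add_one_self)
    then have "exp (I v) * (1 + (I u - I v)) \<le> exp (I v) * exp (I u - I v)"
      by (intro mult_left_mono) auto
    then have "exp (I v) - exp (I u) \<le> exp (I v) * (I v - I u)"
      by (simp add: exp_diff algebra_simps)
    also have "\<dots> \<le> exp (I T) * (C * (v - u))"
      using uv I[of u v] I[of v T] by (intro mult_mono) auto
    finally show "\<bar>exp (I v) - exp (I u)\<bar> \<le> exp (I T) * C * (v - u)"
      using I(1)[OF uv(1,2)] by (simp add: mult.assoc)
  qed
  define N1 where "N1 = {t \<in> {t0..}. \<not> (\<exists>x'. (x has_real_derivative x') (at t) \<and>
      x' + (\<Sum>k=1..1::nat. A t * x t) = 0)}"
  define N2 where "N2 = {t \<in> {t0<..<T}. \<not> (I has_real_derivative A t) (at t)}"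
  have "negligible N1"
    using sol unfolding is_solution_def N1_def by (subst (asm) AE_lebesgue_on_iff_negligible) auto
  moreover have "negligible N2"
    using integral_has_real_derivative_AE[OF A_int] unfolding N2_def I_def by blast
  \<comment> \<open>The derivative of \<open>I\<close> is known only inside
    \<open>{t0<..<T}\<close>, so the end points join the null set.\<close>
  ultimately have N: "negligible (N1 \<union> N2 \<union> {t0, T})" by (intro negligible_Un) auto
  have "x T * exp (I T) = x t0 * exp (I t0)"
  proof (rule absolutely_continuous_deriv_zero_imp_eq[OF absolutely_continuous_mult[OF acx acE] _ N])
    fix t assume t: "t \<in> {t0..T} - (N1 \<union> N2 \<union> {t0, T})"
    then have I': "(I has_real_derivative A t) (at t)" by (auto simp: N2_def)
    have "t \<in> {t0..}" "t \<notin> N1" using t by auto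
    then obtain x' where x': "(x has_real_derivative x') (at t)" "x' + A t * x t = 0"
      unfolding N1_def by auto
    then have x'_eq: "x' = - (A t * x t)" by linarith
    show "((\<lambda>t. x t * exp (I t)) has_real_derivative 0) (at t)"
      by (rule derivative_eq_intros x'(1) I' refl)+ (simp add: x'_eq)
  qed (use T in auto)
  then have "x T * exp (I T) = x0" using x0 by (simp add: I_def)
  then show ?thesis by (simp add: I_def exp_minus field_simps)
qed

subsection \<open>The delay equation\<close>

text \<open>The upper limit \<open>max t0 t\<close> freezes the integral at 0 to the left of
  \<open>t0\<close>. The integral equation thus makes sense on the whole line, as the type of
  bounded continuous functions on the reals requires.\<close>

lemma continuous_on_integral_max:
  fixes g :: "real \<Rightarrow> real"
  assumes "\<And>T. g integrable_on {t0..T}"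
  shows "continuous_on UNIV (\<lambda>t. integral {t0..max t0 t} g)"
proof -
  have "isCont (\<lambda>t. integral {t0..max t0 t} g) t" for t
  proof -
    define T where "T = max t0 t + 1"
    have "continuous_on {t0..T} (\<lambda>s. integral {t0..s} g)"
      by (rule indefinite_integral_continuous_1[OF assms])
    then have "continuous_on {..<T} (\<lambda>t. integral {t0..max t0 t} g)"
      by (rule continuous_on_compose2) (auto intro!: continuous_intros simp: T_def)
    then show ?thesis
      by (auto simp: continuous_on_eq_continuous_at T_def)
  qed
  then show ?thesis by (simp add: continuous_on_eq_continuous_at)
qed

text \<open>All conditions are imposed at every real \<open>t\<close>; the data of the theorem are
  brought to this form by changes on a null set and at negative arguments.\<close>

locale bounded_delay_equation =
  fixes m :: nat and a h :: "nat \<Rightarrow> real \<Rightarrow> real" and C :: real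
  assumes a_measurable: "k \<in> {1..m} \<Longrightarrow> a k \<in> borel_measurable lebesgue"
    and h_measurable: "k \<in> {1..m} \<Longrightarrow> h k \<in> borel_measurable lebesgue"
    and a_nonneg: "k \<in> {1..m} \<Longrightarrow> 0 \<le> a k t"
    and h_le: "k \<in> {1..m} \<Longrightarrow> h k t \<le> t"
    and sum_a_le: "(\<Sum>k=1..m. a k t) \<le> C"
begin

definition A :: "real \<Rightarrow> real" where
  "A t = (\<Sum>k=1..m. a k t)"

definition delayed :: "(real \<Rightarrow> real) \<Rightarrow> real \<Rightarrow> real" where
  "delayed x t = (\<Sum>k=1..m. a k t * x (h k t))"

lemma A_measurable: "A \<in> borel_measurable lebesgue"
  unfolding A_def by (intro borel_measurable_sum a_measurable)

lemma A_nonneg: "0 \<le> A t"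
  unfolding A_def by (intro sum_nonneg a_nonneg)

lemma A_le: "A t \<le> C"
  unfolding A_def by (rule sum_a_le)

lemma C_nonneg: "0 \<le> C"
  using A_nonneg A_le order_trans by blast

lemma A_integrable: "A integrable_on {s..t}"
  using A_nonneg A_le by (intro bounded_measurable_integrable_on_interval[OF A_measurable, of _ _ C]) auto

text \<open>As \<open>h k\<close> is only Lebesgue measurable, composing it with \<open>x\<close> is
  safe when \<open>x\<close> is Borel; continuity ensures this.\<close>

lemma delayed_measurable:
  assumes "continuous_on UNIV x"
  shows "delayed x \<in> borel_measurable lebesgue"
  unfolding delayed_def
  by (intro borel_measurable_sum borel_measurable_times a_measurable
      measurable_compose[OF h_measurable borel_measurable_continuous_onI[OF assms]])

lemma abs_delayed_le:
  assumes "\<And>r. r \<le> t \<Longrightarrow> \<bar>x r\<bar> \<le> K"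
  shows "\<bar>delayed x t\<bar> \<le> A t * K"
proof -
  have "\<bar>delayed x t\<bar> \<le> (\<Sum>k=1..m. \<bar>a k t * x (h k t)\<bar>)"
    unfolding delayed_def by (rule sum_abs)
  also have "\<dots> \<le> (\<Sum>k=1..m. a k t * K)"
    by (rule sum_mono) (simp add: abs_mult a_nonneg assms h_le mult_left_mono)
  finally show ?thesis by (simp add: A_def sum_distrib_right)
qed

lemma delayed_diff: "delayed (\<lambda>t. x t - y t) s = delayed x s - delayed y s"
  by (simp add: delayed_def right_diff_distrib sum_subtractf)

lemma delayed_integrable:
  assumes x: "continuous_on UNIV x" and K: "\<And>r. r \<le> T \<Longrightarrow> \<bar>x r\<bar> \<le> K"
  shows "delayed x integrable_on {s..T}"
proof (rule bounded_measurable_integrable_on_interval[OF delayed_measurable[OF x]])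
  fix t assume "t \<in> {s..T}"
  then have "\<bar>delayed x t\<bar> \<le> A t * K" using K by (intro abs_delayed_le) auto
  also have "\<dots> \<le> C * K" using K[of T] by (intro mult_right_mono A_le) auto
  finally show "\<bar>delayed x t\<bar> \<le> C * K" .
qed

text \<open>Banach's fixed point theorem in the norm \<open>sup |x t| / w t\<close> with
  \<open>w t = exp ((2 * C + 2) * (max t0 t - t0))\<close>; this weight makes the integral operator a contraction
  with factor \<open>1/2\<close> on the whole half-line. The initial data are identically \<open>1\<close>, which makes \<open>x\<close>
  continuous on all of \<open>\<real>\<close> and hence \<open>x \<circ> h k\<close> measurable.\<close>

lemma exists_integral_solution:
  obtains x where "continuous_on UNIV x"
    "\<And>t. x t = 1 - integral {t0..max t0 t} (delayed x)"
proof -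
  \<comment> \<open>Integrating the weight produces the factor \<open>C / \<kappa>\<close>, which
    must be at most 1/2; the summand 2 keeps \<open>\<kappa>\<close> positive when
    \<open>C = 0\<close>.\<close>
  define \<kappa> where "\<kappa> = 2 * C + 2"
  have \<kappa>: "\<kappa> > 0" "C \<le> \<kappa> / 2" using C_nonneg by (auto simp: \<kappa>_def)
  define w where "w t = exp (\<kappa> * (max t0 t - t0))" for t
  have w_cont: "continuous_on UNIV w"
    unfolding w_def by (intro continuous_intros)
  have w_pos: "w t > 0" for t by (simp add: w_def)
  have w_ge: "w t \<ge> 1" for t using \<kappa> by (simp add: w_def)
  \<comment> \<open>Delays look back, so a monotone weight at \<open>s\<close> dominates the weights
    at all arguments \<open>h k s\<close>.\<close>
  have w_mono: "w r \<le> w s" if "r \<le> s" for r s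
    using that \<kappa> by (simp add: w_def max_def)
  have int: "delayed u integrable_on {t0..T}"
    if "continuous_on UNIV u" "\<And>r. \<bar>u r\<bar> \<le> w r * K" "0 \<le> K" for u K T
  proof (rule delayed_integrable[OF that(1)])
    show "\<bar>u r\<bar> \<le> w T * K" if "r \<le> T" for r
      using order_trans[OF \<open>\<And>r. \<bar>u r\<bar> \<le> w r * K\<close> mult_right_mono[OF w_mono[OF that] \<open>0 \<le> K\<close>]] .
  qed
  have bound: "\<bar>integral {t0..max t0 t} (delayed u)\<bar> \<le> w t * (K / 2)"
    if u: "continuous_on UNIV u" "\<And>r. \<bar>u r\<bar> \<le> w r * K" "0 \<le> K" for u K t
  proof -
    define T where "T = max t0 t"
    have T: "t0 \<le> T" by (simp add: T_def)
    let ?g = "\<lambda>s. C * K * exp (\<kappa> * (s - t0))"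
    have g: "(?g has_integral C * K / \<kappa> * exp (\<kappa> * (T - t0)) - C * K / \<kappa> * exp (\<kappa> * (t0 - t0))) {t0..T}"
      using \<kappa> by (intro fundamental_theorem_of_calculus[OF T])
        (auto intro!: derivative_eq_intros simp flip: has_real_derivative_iff_has_vector_derivative)
    have "norm (integral {t0..T} (delayed u)) \<le> integral {t0..T} ?g"
    proof (rule integral_norm_bound_integral)
      show "delayed u integrable_on {t0..T}" by (rule int[OF u])
      show "?g integrable_on {t0..T}" using g by blast
      fix s assume s: "s \<in> {t0..T}"
      have "\<bar>delayed u s\<bar> \<le> A s * (w s * K)"
      proof (rule abs_delayed_le)
        show "\<bar>u r\<bar> \<le> w s * K" if "r \<le> s" for r
          using order_trans[OF u(2) mult_right_mono[OF w_mono[OF that] u(3)]] .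
      qed
      also have "\<dots> \<le> C * (w s * K)"
        using u(3) w_pos[of s] by (intro mult_right_mono A_le) auto
      also have "\<dots> = ?g s" using s by (simp add: w_def)
      finally show "norm (delayed u s) \<le> ?g s" by simp
    qed
    also have "\<dots> \<le> C * K / \<kappa> * exp (\<kappa> * (T - t0))"
      using integral_unique[OF g] \<kappa> u(3) C_nonneg by simp
    also have "\<dots> \<le> K / 2 * exp (\<kappa> * (T - t0))"
    proof (rule mult_right_mono)
      show "C * K / \<kappa> \<le> K / 2"
        using mult_right_mono[OF \<kappa>(2) u(3)] \<kappa>(1) by (simp add: divide_simps mult.commute)
    qed simp
    also have "\<dots> = w t * (K / 2)" by (simp add: w_def T_def)
    finally show ?thesis by (simp add: T_def)
  qed
  \<comment> \<open>\<open>X\<close> identifies bounded continuous functions with continuous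
    functions of finite weighted norm, so \<open>dist y z\<close> is the weighted distance of
    \<open>X y\<close> and \<open>X z\<close>.\<close>
  define X where "X y t = w t * apply_bcontfun y t" for y :: "real \<Rightarrow>\<^sub>C real" and t
  have X_cont: "continuous_on UNIV (X y)" for y
    unfolding X_def by (intro continuous_intros w_cont) simp
  have X_bound: "\<bar>X y r\<bar> \<le> w r * norm y" for y r
    using norm_bounded[of y r] w_pos[of r] by (simp add: X_def abs_mult)
  \<comment> \<open>The integral operator, divided by the weight to return to bounded
    functions.\<close>
  define F where "F y t = (1 - integral {t0..max t0 t} (delayed (X y))) / w t" for y t
  have F: "F y \<in> bcontfun" for y
  proof (rule bcontfun_normI)
    show "continuous_on UNIV (F y)"
      unfolding F_def using w_pos
      by (intro continuous_intros w_cont continuous_on_integral_max int[OF X_cont X_bound])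
        (auto simp: less_imp_neq[symmetric])
    fix t
    have "\<bar>1 - integral {t0..max t0 t} (delayed (X y))\<bar> \<le> 1 + w t * (norm y / 2)"
      using bound[OF X_cont X_bound norm_ge_zero, of t y] by linarith
    also have "\<dots> \<le> w t * (1 + norm y / 2)" using w_ge[of t] by (simp add: algebra_simps)
    finally show "norm (F y t) \<le> 1 + norm y / 2"
      using w_pos[of t] by (simp add: F_def pos_divide_le_eq mult.commute)
  qed
  have "\<exists>!y. Bcontfun (F y) = y"
  proof (rule banach_fix_type[of "1/2"])
    show "\<forall>y z. dist (Bcontfun (F y)) (Bcontfun (F z)) \<le> 1/2 * dist y z"
    proof (intro allI dist_bound)
      fix y z t
      have d: "\<bar>X y r - X z r\<bar> \<le> w r * dist y z" for r
        using dist_bounded[of y r z] w_pos[of r]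
        by (simp add: X_def dist_real_def abs_mult flip: right_diff_distrib)
      have i: "delayed (X y) integrable_on {t0..max t0 t}" for y
        by (rule int[OF X_cont X_bound norm_ge_zero])
      have "integral {t0..max t0 t} (delayed (X z)) - integral {t0..max t0 t} (delayed (X y)) =
          - integral {t0..max t0 t} (delayed (\<lambda>r. X y r - X z r))"
        using i by (simp add: delayed_diff[abs_def] Henstock_Kurzweil_Integration.integral_diff)
      then have "F y t - F z t = - integral {t0..max t0 t} (delayed (\<lambda>r. X y r - X z r)) / w t"
        by (simp add: F_def flip: diff_divide_distrib)
      moreover have "\<bar>integral {t0..max t0 t} (delayed (\<lambda>r. X y r - X z r))\<bar> \<le> w t * (dist y z / 2)"
        by (intro bound continuous_intros X_cont d) simp
      ultimately show "dist (apply_bcontfun (Bcontfun (F y)) t) (apply_bcontfun (Bcontfun (F z)) t) \<le> 1/2 * dist y z"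
        using w_pos[of t] by (simp add: Bcontfun_inverse F dist_real_def pos_divide_le_eq mult.commute)
    qed
  qed auto
  then obtain y where y: "Bcontfun (F y) = y" by blast
  then have "apply_bcontfun y = F y" using Bcontfun_inverse[OF F] by metis
  then have "X y t = w t * F y t" for t by (simp add: X_def)
  then have "X y t = 1 - integral {t0..max t0 t} (delayed (X y))" for t
    using w_pos[of t] by (simp add: F_def)
  with X_cont that show thesis by blast
qed

text \<open>One solution serves all \<open>T\<close>, which the limit argument for asymptotic
  stability requires.\<close>

lemma exists_solution_ge:
  obtains x where "is_solution m a h t0 (\<lambda>_. 1) 1 x"
    "\<And>T. t0 \<le> T \<Longrightarrow> integral {t0..T} A \<le> 1/4 \<Longrightarrow> 2/3 \<le> x T"
proof -
  obtain x where x: "continuous_on UNIV x" "\<And>t. x t = 1 - integral {t0..max t0 t} (delayed x)"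
    using exists_integral_solution[of t0] by blast
  have x1: "x t = 1" if "t \<le> t0" for t using x(2)[of t] that by (simp add: max_absorb1)
  \<comment> \<open>Before \<open>t0\<close> the modulus is 1, its value at \<open>t0\<close>, so a
    maximum over \<open>{t0..T}\<close> dominates the whole past.\<close>
  have max_on: "\<exists>\<tau>\<in>{t0..T}. \<forall>r\<le>T. \<bar>x r\<bar> \<le> \<bar>x \<tau>\<bar>" if "t0 \<le> T" for T
  proof -
    have "continuous_on {t0..T} (\<lambda>r. \<bar>x r\<bar>)"
      by (intro continuous_intros continuous_on_subset[OF x(1)]) simp
    then obtain \<tau> where \<tau>: "\<tau> \<in> {t0..T}" "\<forall>r\<in>{t0..T}. \<bar>x r\<bar> \<le> \<bar>x \<tau>\<bar>"
      using continuous_attains_sup[of "{t0..T}" "\<lambda>r. \<bar>x r\<bar>"] \<open>t0 \<le> T\<close> by auto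
    moreover have "\<bar>x r\<bar> \<le> \<bar>x \<tau>\<bar>" if "r < t0" for r
      using \<tau>(2)[rule_format, of t0] \<open>t0 \<le> T\<close> x1[of r] x1[of t0] that by simp
    ultimately show ?thesis by (metis atLeastAtMost_iff not_le)
  qed
  have int: "delayed x integrable_on {t0..T}" for T
  proof (cases "t0 \<le> T")
    case True
    then show ?thesis using max_on delayed_integrable[OF x(1)] by blast
  qed auto
  have "is_solution m a h t0 (\<lambda>_. 1) 1 x"
    unfolding is_solution_def
  proof (intro conjI allI impI)
    show "x t = 1" if "t < t0" for t using that x1 by simp
    show "x t0 = 1" using x1 by simp
    show "locally_absolutely_continuous_from t0 x"
      unfolding locally_absolutely_continuous_from_def
    proof (intro allI impI)
      fix d assume d: "t0 < d"
      obtain \<tau> where \<tau>: "\<And>r. r \<le> d \<Longrightarrow> \<bar>x r\<bar> \<le> \<bar>x \<tau>\<bar>"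
        using max_on[of d] d by auto
      show "absolutely_continuous_on_interval t0 d x"
      proof (rule absolutely_continuous_Lipschitz)
        fix u v assume uv: "t0 \<le> u" "u \<le> v" "v \<le> d"
        have "integral {t0..u} (delayed x) + integral {u..v} (delayed x) = integral {t0..v} (delayed x)"
          using uv by (intro Henstock_Kurzweil_Integration.integral_combine int) auto
        then have "\<bar>x v - x u\<bar> = \<bar>integral {u..v} (delayed x)\<bar>"
          using x(2)[of u] x(2)[of v] uv by (simp add: max_absorb2)
        also have "\<dots> \<le> integral {u..v} (\<lambda>_. C * \<bar>x \<tau>\<bar>)"
        proof (rule integral_norm_bound_integral[where f = "delayed x", unfolded real_norm_def])
          show "delayed x integrable_on {u..v}"
            using integrable_subinterval_real[OF int] uv by auto
          fix s assume s: "s \<in> {u..v}"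
          have "\<bar>delayed x s\<bar> \<le> A s * \<bar>x \<tau>\<bar>" using s uv \<tau> by (intro abs_delayed_le) auto
          also have "\<dots> \<le> C * \<bar>x \<tau>\<bar>" by (intro mult_right_mono A_le) auto
          finally show "\<bar>delayed x s\<bar> \<le> C * \<bar>x \<tau>\<bar>" .
        qed auto
        finally show "\<bar>x v - x u\<bar> \<le> C * \<bar>x \<tau>\<bar> * (v - u)" using uv by (simp add: mult_ac)
      qed
    qed
    let ?P = "\<lambda>t. \<exists>x'. (x has_real_derivative x') (at t) \<and> x' + (\<Sum>k=1..m. a k t * x (h k t)) = 0"
    \<comment> \<open>Differentiability of the integral is known on bounded intervals; countably
      many exhaust the half-line.\<close>
    define N where "N n = {t \<in> {t0<..<t0 + real n}.
        \<not> ((\<lambda>t. integral {t0..t} (delayed x)) has_real_derivative delayed x t) (at t)}" for n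
    have "negligible (insert t0 (\<Union>n. N n))"
      unfolding negligible_insert N_def by (intro negligible_Union_nat integral_has_real_derivative_AE int)
    moreover have "{t \<in> {t0..}. \<not> ?P t} \<subseteq> insert t0 (\<Union>n. N n)"
    proof (rule subsetI, rule ccontr)
      fix t assume t: "t \<in> {t \<in> {t0..}. \<not> ?P t}" and nin: "t \<notin> insert t0 (\<Union>n. N n)"
      obtain n where n: "t < t0 + real n"
        using reals_Archimedean2[of "t - t0"] by (auto simp: algebra_simps)
      have "t \<notin> N n" using nin by blast
      then have D: "((\<lambda>t. integral {t0..t} (delayed x)) has_real_derivative delayed x t) (at t)"
        using t nin n by (auto simp: N_def)
      have "t > t0" using t nin by auto
      have "((\<lambda>t. 1 - integral {t0..t} (delayed x)) has_real_derivative - delayed x t) (at t)"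
        by (rule derivative_eq_intros D refl)+ simp
      then have "(x has_real_derivative - delayed x t) (at t)"
      proof (rule has_field_derivative_transform_within_open[where S="{t0<..}"])
        show "1 - integral {t0..s} (delayed x) = x s" if "s \<in> {t0<..}" for s
          using x(2)[of s] that by (simp add: max_absorb2)
      qed (use \<open>t > t0\<close> in auto)
      then have "?P t" by (intro exI[of _ "- delayed x t"]) (simp add: delayed_def)
      with t show False by blast
    qed
    ultimately have "negligible {t \<in> {t0..}. \<not> ?P t}" by (rule negligible_subset)
    then show "AE t in lebesgue_on {t0..}. ?P t"
      by (subst AE_lebesgue_on_iff_negligible) simp_all
  qed
  moreover have "2/3 \<le> x T" if T: "t0 \<le> T" and small: "integral {t0..T} A \<le> 1/4" for T
  proof -
    obtain \<tau> where \<tau>: "\<tau> \<in> {t0..T}" "\<And>r. r \<le> T \<Longrightarrow> \<bar>x r\<bar> \<le> \<bar>x \<tau>\<bar>"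
      using max_on[OF T] by blast
    have dev: "\<bar>x s - 1\<bar> \<le> \<bar>x \<tau>\<bar> / 4" if s: "s \<in> {t0..T}" for s
    proof -
      have "\<bar>x s - 1\<bar> = \<bar>integral {t0..s} (delayed x)\<bar>"
        using x(2)[of s] s by (simp add: max_absorb2)
      also have "\<dots> \<le> integral {t0..s} (\<lambda>r. A r * \<bar>x \<tau>\<bar>)"
        using s \<tau>(2) by (intro integral_norm_bound_integral[where f = "delayed x", unfolded real_norm_def]
            int integrable_on_mult_left A_integrable abs_delayed_le) auto
      also have "\<dots> = integral {t0..s} A * \<bar>x \<tau>\<bar>" by simp
      also have "\<dots> \<le> integral {t0..T} A * \<bar>x \<tau>\<bar>"
        using s integral_interval_bounds(1)[OF A_integrable A_nonneg A_le, of t0 s T]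
        by (intro mult_right_mono) auto
      also have "\<dots> \<le> 1/4 * \<bar>x \<tau>\<bar>" by (intro mult_right_mono small) simp
      finally show ?thesis by simp
    qed
    have "\<bar>x T - 1\<bar> \<le> \<bar>x \<tau>\<bar> / 4" using T by (intro dev) simp
    \<comment> \<open>At \<open>\<tau>\<close> the estimate gives
      \<open>\<bar>x \<tau>\<bar> \<le> 4/3\<close>, hence a deviation of at most 1/3 at
      \<open>T\<close>.\<close>
    with dev[OF \<tau>(1)] show ?thesis by linarith
  qed
  ultimately show thesis by (rule that)
qed
end

subsection \<open>Stability\<close>

text \<open>A real supremum is controlled only for nonempty sets bounded above;
  \<open>initial_function\<close> supplies the bound and \<open>t0 - 1\<close> an element.\<close>

lemma SUP_initial_function_nonneg:
  assumes "initial_function t0 \<phi>"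
  shows "0 \<le> (SUP t\<in>{..<t0}. \<bar>\<phi> t\<bar>)"
proof -
  obtain K where "\<And>t. t < t0 \<Longrightarrow> \<bar>\<phi> t\<bar> \<le> K"
    using assms unfolding initial_function_def bounded_iff by auto
  then have "bdd_above ((\<lambda>t. \<bar>\<phi> t\<bar>) ` {..<t0})" by (auto simp: bdd_above_def)
  then show ?thesis by (rule cSUP_upper2[of _ _ "t0 - 1"]) auto
qed

lemma initial_function_const: "initial_function t0 (\<lambda>_. c)"
  by (simp add: initial_function_def image_constant_conv)

text \<open>The equation is required only almost everywhere, so essentially bounded coefficients may
  be replaced by bounded ones.\<close>

lemma is_solution_cong:
  assumes eq: "AE t in lebesgue_on {0..}. \<forall>k\<in>{1..m}. a k t = a' k t \<and> h k t = h' k t" and t0: "0 \<le> t0"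
  shows "is_solution m a h t0 \<phi> x0 x \<longleftrightarrow> is_solution m a' h' t0 \<phi> x0 x"
proof -
  have "AE t in lebesgue_on {t0..}. \<forall>k\<in>{1..m}. a k t = a' k t \<and> h k t = h' k t"
    using eq t0 by (simp add: AE_lebesgue_on_iff_negligible) (erule negligible_subset, auto)
  then have sum_eq: "AE t in lebesgue_on {t0..}. (\<Sum>k=1..m. a k t * x (h k t)) = (\<Sum>k=1..m. a' k t * x (h' k t))"
    by (rule AE_mp) (auto intro!: AE_I2 sum.cong)
  have "(AE t in lebesgue_on {t0..}. \<exists>x'. (x has_real_derivative x') (at t) \<and> x' + (\<Sum>k=1..m. a k t * x (h k t)) = 0) \<longleftrightarrow>
    (AE t in lebesgue_on {t0..}. \<exists>x'. (x has_real_derivative x') (at t) \<and> x' + (\<Sum>k=1..m. a' k t * x (h' k t)) = 0)"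
    by (rule eventually_subst) (use sum_eq in \<open>eventually_elim, simp\<close>)
  then show ?thesis by (simp add: is_solution_def)
qed

lemma asymptotically_stable_cong:
  assumes "AE t in lebesgue_on {0..}. \<forall>k\<in>{1..m}. a k t = a' k t \<and> h k t = h' k t"
  shows "asymptotically_stable m a h \<longleftrightarrow> asymptotically_stable m a' h'"
  unfolding asymptotically_stable_def stable_def by (simp add: is_solution_cong[OF assms] cong: imp_cong)

lemma exponentially_stable_cong:
  assumes "AE t in lebesgue_on {0..}. \<forall>k\<in>{1..m}. a k t = a' k t \<and> h k t = h' k t"
  shows "exponentially_stable m a h \<longleftrightarrow> exponentially_stable m a' h'"
  unfolding exponentially_stable_def by (simp add: is_solution_cong[OF assms] cong: imp_cong)

section \<open>Transfer of stability to the ordinary equation\<close>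

context bounded_delay_equation
begin

lemma asymptotically_stable_ode:
  assumes stab: "asymptotically_stable m a h"
  shows "asymptotically_stable 1 (\<lambda>_. A) (\<lambda>_ t. t)"
  unfolding asymptotically_stable_def stable_def
proof (intro conjI allI impI)
  fix t0 \<epsilon> :: real assume t0: "0 \<le> t0" and \<epsilon>: "0 < \<epsilon>"
  show "\<exists>\<delta>>0. \<forall>\<phi> x0 x. initial_function t0 \<phi> \<and> is_solution 1 (\<lambda>_. A) (\<lambda>_ t. t) t0 \<phi> x0 x \<and>
          (SUP t\<in>{..<t0}. \<bar>\<phi> t\<bar>) + \<bar>x0\<bar> < \<delta> \<longrightarrow> (\<forall>t\<ge>t0. \<bar>x t\<bar> < \<epsilon>)"
  \<comment> \<open>Since \<open>A \<ge> 0\<close>, no solution exceeds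
    \<open>\<bar>x0\<bar>\<close> in modulus, so \<open>\<epsilon>\<close> itself serves as
    \<open>\<delta>\<close>.\<close>
  proof (intro exI[of _ \<epsilon>] conjI allI impI \<epsilon>)
    fix \<phi> x x0 t assume H: "initial_function t0 \<phi> \<and> is_solution 1 (\<lambda>_. A) (\<lambda>_ t. t) t0 \<phi> x0 x \<and>
          (SUP t\<in>{..<t0}. \<bar>\<phi> t\<bar>) + \<bar>x0\<bar> < \<epsilon>" and t: "t0 \<le> t"
    have "\<bar>x t\<bar> = \<bar>x0\<bar> * exp (- integral {t0..t} A)"
      using H t by (subst ode_solution_eq[OF A_measurable A_nonneg A_le]) (auto simp: abs_mult)
    also have "\<dots> \<le> \<bar>x0\<bar> * 1"
      using A_nonneg by (intro mult_left_mono) (auto intro!: integral_nonneg A_integrable)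
    also have "\<dots> < \<epsilon>" using H SUP_initial_function_nonneg[of t0 \<phi>] by auto
    finally show "\<bar>x t\<bar> < \<epsilon>" .
  qed
next
  fix t0 \<phi> x0 x
  assume t0: "0 \<le> t0" and H: "initial_function t0 \<phi> \<and> is_solution 1 (\<lambda>_. A) (\<lambda>_ t. t) t0 \<phi> x0 x"
  have step: "\<exists>T\<ge>s. 1/4 < integral {s..T} A" if s: "0 \<le> s" for s
  proof (rule ccontr)
    assume neg: "\<not> ?thesis"
    obtain y where y: "is_solution m a h s (\<lambda>_. 1) 1 y"
      "\<And>T. s \<le> T \<Longrightarrow> integral {s..T} A \<le> 1/4 \<Longrightarrow> 2/3 \<le> y T"
      using exists_solution_ge[of s] by blast
    have "(y \<longlongrightarrow> 0) at_top"
      using stab y(1) s initial_function_const unfolding asymptotically_stable_def by blast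
    then have "\<forall>\<^sub>F T in at_top. y T < 2/3" by (rule order_tendstoD) simp
    moreover have "\<forall>\<^sub>F T in at_top. 2/3 \<le> y T"
      using eventually_ge_at_top[of s] by eventually_elim (use y(2) neg in force)
    ultimately have "\<forall>\<^sub>F T :: real in at_top. False" by eventually_elim simp
    then show False by simp
  qed
  \<comment> \<open>\<open>step\<close> applies afresh at the end of each block, so blocks of
    integral above 1/4 can be chained.\<close>
  have diverge: "\<exists>T\<ge>t0. real n / 4 \<le> integral {t0..T} A" for n
  proof (induction n)
    case 0
    show ?case by (intro exI[of _ t0]) simp
  next
    case (Suc n)
    then obtain T where T: "t0 \<le> T" "real n / 4 \<le> integral {t0..T} A" by blast
    obtain T' where T': "T \<le> T'" "1/4 < integral {T..T'} A" using step[of T] T t0 by auto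
    have "integral {t0..T} A + integral {T..T'} A = integral {t0..T'} A"
      using T T' by (intro Henstock_Kurzweil_Integration.integral_combine A_integrable) auto
    then show ?case using T T' by (intro exI[of _ T']) auto
  qed
  have "filterlim (\<lambda>t. integral {t0..t} A) at_top at_top"
    unfolding filterlim_at_top
  proof
    fix Z :: real
    obtain n where n: "4 * Z \<le> real n" using real_arch_simple by blast
    obtain T where T: "t0 \<le> T" "real n / 4 \<le> integral {t0..T} A" using diverge by blast
    show "\<forall>\<^sub>F t in at_top. Z \<le> integral {t0..t} A"
      using eventually_ge_at_top[of T]
    proof eventually_elim
      case (elim t)
      then show ?case
        using integral_interval_bounds(1)[OF A_integrable A_nonneg A_le T(1), of t] T(2) n by simp
    qed
  qed
  then have "((\<lambda>t. x0 * exp (- integral {t0..t} A)) \<longlongrightarrow> 0) at_top"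
    by (intro tendsto_mult_right_zero filterlim_compose[OF exp_at_bot] filterlim_compose[OF filterlim_uminus_at_bot_at_top])
  then show "(x \<longlongrightarrow> 0) at_top"
  proof (rule Lim_transform_eventually)
    show "\<forall>\<^sub>F t in at_top. x0 * exp (- integral {t0..t} A) = x t"
      using eventually_ge_at_top[of t0]
      by eventually_elim (use H ode_solution_eq[OF A_measurable A_nonneg A_le] in auto)
  qed
qed

text \<open>Blocks of a common length \<open>L\<close> make the integral of \<open>A\<close> grow at
  least linearly with slope \<open>1 / (4 * L)\<close>, up to a loss of 1/4. This gives the rate
  \<open>1 / (4 * L)\<close> and the constant \<open>exp (1/4)\<close>.\<close>

lemma exponentially_stable_ode:
  assumes stab: "exponentially_stable m a h"
  shows "exponentially_stable 1 (\<lambda>_. A) (\<lambda>_ t. t)"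
proof -
  obtain M \<mu> where M: "M > 0" and \<mu>: "\<mu> > 0" and decay: "\<forall>t0\<ge>0. \<forall>\<phi> x0 x.
      initial_function t0 \<phi> \<and> is_solution m a h t0 \<phi> x0 x \<longrightarrow>
      (\<forall>t\<ge>t0. \<bar>x t\<bar> \<le> M * exp (- \<mu> * (t - t0)) * (\<bar>x0\<bar> + (SUP s\<in>{..<t0}. \<bar>\<phi> s\<bar>)))"
    using stab unfolding exponentially_stable_def by (elim exE conjE) (rule that)
  \<comment> \<open>After time \<open>L\<close> the exponential bound for the initial data \<open>1\<close> has dropped below \<open>2/3\<close>.\<close>
  define L where "L = 3 * M / \<mu>"
  have L: "L > 0" using M \<mu> by (simp add: L_def)
  \<comment> \<open>The factor 2 is \<open>\<bar>x0\<bar>\<close> plus the supremum of the initial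
    function, both 1. The claim amounts to \<open>3 * M < exp (\<mu> * L)\<close>, which holds
    because \<open>\<mu> * L = 3 * M\<close>.\<close>
  have small: "M * exp (- \<mu> * L) * 2 < 2/3"
  proof -
    have "3 * M < exp (\<mu> * L)"
    proof -
      have "\<mu> * L = 3 * M" using \<mu> by (simp add: L_def)
      then show ?thesis using exp_ge_add_one_self[of "\<mu> * L"] by linarith
    qed
    then show ?thesis by (simp add: exp_minus field_simps)
  qed
  have step: "1/4 \<le> integral {s..s + L} A" if s: "0 \<le> s" for s
  proof (rule ccontr)
    assume neg: "\<not> ?thesis"
    obtain y where y: "is_solution m a h s (\<lambda>_. 1) 1 y"
      "\<And>T. s \<le> T \<Longrightarrow> integral {s..T} A \<le> 1/4 \<Longrightarrow> 2/3 \<le> y T"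
      using exists_solution_ge[of s] by blast
    have "2/3 \<le> y (s + L)" using y(2) neg L by simp
    moreover have "\<bar>y (s + L)\<bar> \<le> M * exp (- \<mu> * L) * 2"
      using decay[rule_format, OF s conjI[OF initial_function_const y(1)], of "s + L"] L by simp
    ultimately show False using small by linarith
  qed
  have iterate: "real n / 4 \<le> integral {s..s + real n * L} A" if s: "0 \<le> s" for s n
  proof (induction n)
    case (Suc n)
    have nL: "0 \<le> real n * L" using L by simp
    have eq: "s + real (Suc n) * L = s + real n * L + L" by (simp add: algebra_simps)
    have "integral {s..s + real n * L} A + integral {s + real n * L..s + real n * L + L} A
        = integral {s..s + real n * L + L} A"
      using L nL by (intro Henstock_Kurzweil_Integration.integral_combine A_integrable) auto
    then show ?case using Suc step[of "s + real n * L"] s nL unfolding eq by simp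
  qed simp
  have lower: "(t - s) / (4 * L) - 1/4 \<le> integral {s..t} A" if s: "0 \<le> s" "s \<le> t" for s t
  proof -
    \<comment> \<open>\<open>n\<close> counts the complete blocks in \<open>{s..t}\<close>; dropping
      the incomplete last one costs at most 1/4.\<close>
    define n where "n = nat \<lfloor>(t - s) / L\<rfloor>"
    have q: "0 \<le> (t - s) / L" using s L by simp
    have n: "real n \<le> (t - s) / L" "(t - s) / L < real n + 1"
      using q unfolding n_def by linarith+
    have nL: "s + real n * L \<le> t" using n(1) L by (simp add: field_simps)
    have "(t - s) / (4 * L) = (t - s) / L / 4" by simp
    then have "(t - s) / (4 * L) - 1/4 \<le> real n / 4" using n(2) by linarith
    also have "\<dots> \<le> integral {s..s + real n * L} A" by (rule iterate[OF s(1)])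
    also have "\<dots> \<le> integral {s..t} A"
      using integral_interval_bounds(1)[OF A_integrable A_nonneg A_le _ nL, of s] L by simp
    finally show ?thesis .
  qed
  show ?thesis
    unfolding exponentially_stable_def
  proof (rule exI[of _ "exp (1/4)"], rule conjI, simp, rule exI[of _ "1 / (4 * L)"], intro conjI allI impI)
    fix t0 \<phi> x0 x t
    assume t0: "0 \<le> t0" and H: "initial_function t0 \<phi> \<and> is_solution 1 (\<lambda>_. A) (\<lambda>_ t. t) t0 \<phi> x0 x"
      and t: "t0 \<le> t"
    have "\<bar>x t\<bar> = exp (- integral {t0..t} A) * \<bar>x0\<bar>"
      using H t by (subst ode_solution_eq[OF A_measurable A_nonneg A_le]) (auto simp: abs_mult)
    also have "\<dots> \<le> exp (1/4 + - (1 / (4 * L)) * (t - t0)) * (\<bar>x0\<bar> + (SUP s\<in>{..<t0}. \<bar>\<phi> s\<bar>))"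
      using lower[OF t0 t] H SUP_initial_function_nonneg[of t0 \<phi>] by (intro mult_mono) auto
    finally show "\<bar>x t\<bar> \<le> exp (1/4) * exp (- (1 / (4 * L)) * (t - t0)) * (\<bar>x0\<bar> + (SUP s\<in>{..<t0}. \<bar>\<phi> s\<bar>))"
      by (simp only: exp_add)
  qed (use L in auto)
qed

end

section \<open>Reduction to coefficients bounded everywhere\<close>

theorem theorem5:
  fixes m :: nat and a h :: "nat \<Rightarrow> real \<Rightarrow> real"
  assumes a_measurable: "\<And>k. k \<in> {1..m} \<Longrightarrow> a k \<in> borel_measurable (lebesgue_on {0..})"
    and a_ess_bounded: "\<And>k. k \<in> {1..m} \<Longrightarrow> \<exists>C. AE t in lebesgue_on {0..}. \<bar>a k t\<bar> \<le> C"
    and h_measurable: "\<And>k. k \<in> {1..m} \<Longrightarrow> h k \<in> borel_measurable (lebesgue_on {0..})"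
    and h_le: "\<And>k t. k \<in> {1..m} \<Longrightarrow> t \<ge> 0 \<Longrightarrow> h k t \<le> t"
    and h_lim: "\<And>k. k \<in> {1..m} \<Longrightarrow> filterlim (h k) at_top at_top"
    and a_nonneg: "\<And>k t. k \<in> {1..m} \<Longrightarrow> t \<ge> 0 \<Longrightarrow> a k t \<ge> 0"
  shows "(asymptotically_stable m a h \<longrightarrow>
            asymptotically_stable 1 (\<lambda>_ t. \<Sum>k=1..m. a k t) (\<lambda>_ t. t)) \<and>
         ((\<forall>k\<in>{1..m}. Limsup at_top (\<lambda>t. ereal (t - h k t)) < \<infinity>) \<and> exponentially_stable m a h \<longrightarrow>
            exponentially_stable 1 (\<lambda>_ t. \<Sum>k=1..m. a k t) (\<lambda>_ t. t))"
proof -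
  obtain D where D: "\<And>k. k \<in> {1..m} \<Longrightarrow> AE t in lebesgue_on {0..}. \<bar>a k t\<bar> \<le> D k"
    using a_ess_bounded by metis
  \<comment> \<open>Truncating at \<open>\<bar>D k\<bar>\<close> keeps the coefficient nonnegative
    whatever the sign of \<open>D k\<close>. For negative \<open>t\<close> the values 0 and
    \<open>t\<close> satisfy the sign and delay conditions of the locale.\<close>
  define a' where "a' k t = (if t \<in> {0..} then min (a k t) \<bar>D k\<bar> else 0)" for k t
  define h' where "h' k t = (if t \<in> {0..} then h k t else t)" for k t
  have "AE t in lebesgue_on {0..}. \<forall>k\<in>{1..m}. \<bar>a k t\<bar> \<le> D k"
    using D by (subst AE_ball_countable) auto
  moreover have "AE t in lebesgue_on {0..}. t \<in> {0..}"
    by (rule AE_I2) simp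
  ultimately have eq: "AE t in lebesgue_on {0..}. \<forall>k\<in>{1..m}. a k t = a' k t \<and> h k t = h' k t"
  proof eventually_elim
    case (elim t)
    show ?case
    proof
      fix k assume "k \<in> {1..m}"
      then have "\<bar>a k t\<bar> \<le> D k" using elim by blast
      then show "a k t = a' k t \<and> h k t = h' k t" using elim by (auto simp: a'_def h'_def)
    qed
  qed
  interpret bounded_delay_equation m a' h' "\<Sum>k=1..m. \<bar>D k\<bar>"
  proof
    fix k t assume k: "k \<in> {1..m}"
    show "a' k \<in> borel_measurable lebesgue"
      unfolding a'_def
      by (intro borel_measurable_if_I borel_measurable_min borel_measurable_const a_measurable[OF k]) simp
    \<comment> \<open>\<open>h k\<close> is known to be measurable only on the half-line, so
      \<open>h'\<close> is split into two pieces, each extended by 0.\<close>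
    have "(\<lambda>t. (if t \<in> {0..} then h k t else 0) + (if t \<in> {0..} then 0 else t)) \<in> borel_measurable lebesgue"
      by (intro borel_measurable_add borel_measurable_if_I h_measurable[OF k] measurable_If measurable_completion) auto
    also have "(\<lambda>t. (if t \<in> {0..} then h k t else 0) + (if t \<in> {0..} then 0 else t)) = h' k"
      by (auto simp: h'_def)
    finally show "h' k \<in> borel_measurable lebesgue" .
    show "0 \<le> a' k t" using a_nonneg[OF k] by (simp add: a'_def)
    show "h' k t \<le> t" using h_le[OF k] by (simp add: h'_def)
  next
    show "(\<Sum>k=1..m. a' k t) \<le> (\<Sum>k=1..m. \<bar>D k\<bar>)" for t
      by (rule sum_mono) (simp add: a'_def)
  qed
  \<comment> \<open>The ordinary equation is a one-term instance, so the same congruence lemmas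
    replace its coefficient by \<open>A\<close>.\<close>
  have "AE t in lebesgue_on {0..}. \<forall>k\<in>{1..1::nat}. (\<Sum>k=1..m. a k t) = A t \<and> t = t"
    using eq by eventually_elim (simp add: A_def)
  note ode_cong = asymptotically_stable_cong[OF this] exponentially_stable_cong[OF this]
  show ?thesis
    unfolding ode_cong asymptotically_stable_cong[OF eq] exponentially_stable_cong[OF eq]
    using asymptotically_stable_ode exponentially_stable_ode by blast
qed

end
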